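(* Let $q$ be a prime power, $2\le d\le q$ and $1\le j\le d-1$. The number of minimum-weight words of the edge code $\mathsf{H}^{j}_d$ (that is, the number $A_d$ of codewords of weight $d$) is $$A_d=q^2(q^2-1)\binom{q}{d}.$$
   Context: Let $\mathcal{H}$ be the Hermitian curve $x^{q+1}=y^q+y$ over $\mathbb{F}_{q^2}$, with its $n=q^3$ affine $\mathbb{F}_{q^2}$-rational points $P_1,\dots,P_n$. For an integer $m$ let $\mathcal{B}_{m,q}=\{x^ry^s : qr+(q+1)s\le m,\ 0\le s\le q-1,\ 0\le r\le q^2-1\}$, and let the Hermitian code $C(m,q)$ be the set of $c\in(\mathbb{F}_{q^2})^n$ with $\sum_{i=1}^n c_i f(P_i)=0$ for all $f\in\mathcal{B}_{m,q}$. For $2\le d\le q$ and $1\le j\le d-1$, the edge code $\mathsf{H}^{j}_d$ is the Hermitian code $C(m,q)$ for which $\mathcal{B}_{m,q}=\{x^ry^s: r,s\ge 0,\ r+s\le d-2\}\cup\{x^{d-i}y^{i-1}: 1\le i\le j\}$. It has minimum distance $d$. *)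

theory Defs
  imports "HOL-Number_Theory.Prime_Powers" "HOL-Library.FuncSet" "HOL-Library.Cardinality"
begin

(* 'a plays the role of the field with q^2 elements (CARD('a) = q^2). *)
definition hermitian_points :: "nat \<Rightarrow> ('a::{field,finite} \<times> 'a) set" where
  "hermitian_points q = {(x, y). x ^ (q + 1) = y ^ q + y}"

(* A word of (F_{q^2})^n has one coordinate for each of the n affine rational points, so it is
   a function on the set of points; outside this set it is undefined (extensional), so that
   different functions are different words. *)
definition words :: "nat \<Rightarrow> ('a::{field,finite} \<times> 'a \<Rightarrow> 'a) set" where
  "words q = hermitian_points q \<rightarrow>\<^sub>E UNIV"

(* The pair (r, s) stands for the monomial x^r y^s. *)
definition eval_monomial :: "nat \<times> nat \<Rightarrow> 'a::field \<times> 'a \<Rightarrow> 'a" where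
  "eval_monomial f P = fst P ^ fst f * snd P ^ snd f"

definition hermitian_monomials :: "int \<Rightarrow> nat \<Rightarrow> (nat \<times> nat) set" where
  "hermitian_monomials m q =
     {(r, s). int (q * r + (q + 1) * s) \<le> m \<and> s \<le> q - 1 \<and> r \<le> q\<^sup>2 - 1}"

definition hermitian_code :: "int \<Rightarrow> nat \<Rightarrow> ('a::{field,finite} \<times> 'a \<Rightarrow> 'a) set" where
  "hermitian_code m q =
     {c \<in> words q. \<forall>f \<in> hermitian_monomials m q.
        (\<Sum>P\<in>hermitian_points q. c P * eval_monomial f P) = 0}"

definition edge_monomials :: "nat \<Rightarrow> nat \<Rightarrow> (nat \<times> nat) set" where
  "edge_monomials d j = {(r, s). r + s \<le> d - 2} \<union> {(d - i, i - 1) | i. 1 \<le> i \<and> i \<le> j}"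

(* Several m may yield the same set of monomials, but they all yield the same code. *)
definition edge_code :: "nat \<Rightarrow> nat \<Rightarrow> nat \<Rightarrow> ('a::{field,finite} \<times> 'a \<Rightarrow> 'a) set" where
  "edge_code q d j =
     (THE C. \<exists>m. hermitian_monomials m q = edge_monomials d j \<and> C = hermitian_code m q)"

definition hamming_distance ::
  "nat \<Rightarrow> ('a::{field,finite} \<times> 'a \<Rightarrow> 'a) \<Rightarrow> ('a \<times> 'a \<Rightarrow> 'a) \<Rightarrow> nat" where
  "hamming_distance q c c' = card {P \<in> hermitian_points q. c P \<noteq> c' P}"

definition hamming_weight :: "nat \<Rightarrow> ('a::{field,finite} \<times> 'a \<Rightarrow> 'a) \<Rightarrow> nat" where
  "hamming_weight q c = card {P \<in> hermitian_points q. c P \<noteq> 0}"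

definition minimum_distance :: "nat \<Rightarrow> ('a::{field,finite} \<times> 'a \<Rightarrow> 'a) set \<Rightarrow> nat" where
  "minimum_distance q C = Inf {hamming_distance q c c' | c c'. c \<in> C \<and> c' \<in> C \<and> c \<noteq> c'}"

definition num_words_of_weight :: "nat \<Rightarrow> ('a::{field,finite} \<times> 'a \<Rightarrow> 'a) set \<Rightarrow> nat \<Rightarrow> nat" where
  "num_words_of_weight q C w = card {c \<in> C. hamming_weight q c = w}"

(* The edge codes are well defined: m = q(d-1) + (j-1) gives the required monomials. *)
lemma hermitian_monomials_edge:
  assumes "2 \<le> d" "d \<le> q" "1 \<le> j" "j \<le> d - 1"
  shows "hermitian_monomials (int (q * (d - 1) + (j - 1))) q = edge_monomials d j"
proof -
  have "(r, s) \<in> hermitian_monomials (int (q * (d - 1) + (j - 1))) q \<longleftrightarrow> (r, s) \<in> edge_monomials d j"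
    for r s
  proof -
    have edge: "(r, s) \<in> edge_monomials d j \<longleftrightarrow> r + s \<le> d - 2 \<or> (r + s = d - 1 \<and> s < j)"
    proof -
      have "(\<exists>i. r = d - i \<and> s = i - 1 \<and> 1 \<le> i \<and> i \<le> j) \<longleftrightarrow> r + s = d - 1 \<and> s < j"
      proof
        assume "r + s = d - 1 \<and> s < j"
        then show "\<exists>i. r = d - i \<and> s = i - 1 \<and> 1 \<le> i \<and> i \<le> j"
          using assms by (intro exI[of _ "Suc s"]) auto
      qed (use assms in auto)
      then show ?thesis by (auto simp: edge_monomials_def)
    qed
    have split: "q * r + (q + 1) * s = q * (r + s) + s" by (simp add: algebra_simps)
    have main: "q * (r + s) + s \<le> q * (d - 1) + (j - 1) \<longleftrightarrow>
        r + s \<le> d - 2 \<or> (r + s = d - 1 \<and> s < j)"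
    proof -
      consider "r + s \<le> d - 2" | "r + s = d - 1" | "d \<le> r + s" by linarith
      then show ?thesis
      proof cases
        case 1
        then have "q * (r + s) \<le> q * (d - 2)" by simp
        moreover have "q * (d - 1) = q * (d - 2) + q"
          using assms(1) by (cases d rule: nat.exhaust) (auto simp: algebra_simps diff_mult_distrib2)
        ultimately show ?thesis using 1 assms by linarith
      next
        case 2
        then show ?thesis using assms by simp linarith
      next
        case 3
        then have "q * d \<le> q * (r + s)" by (meson mult_le_mono2)
        moreover have "q * d = q * (d - 1) + q"
          using assms(1) by (cases d) (auto simp: algebra_simps)
        ultimately show ?thesis using 3 assms by linarith
      qed
    qed
    have "r + s \<le> d - 1 \<Longrightarrow> s \<le> q - 1 \<and> r \<le> q\<^sup>2 - 1"
    proof -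
      have "q \<le> q\<^sup>2" by (simp add: power2_eq_square)
      then show "r + s \<le> d - 1 \<Longrightarrow> s \<le> q - 1 \<and> r \<le> q\<^sup>2 - 1" using assms by linarith
    qed
    then show ?thesis
      unfolding edge hermitian_monomials_def mem_Collect_eq prod.case of_nat_le_iff split main
      by linarith
  qed
  then show ?thesis by auto
qed

lemma edge_code_eq:
  assumes "hermitian_monomials m q = edge_monomials d j"
  shows "edge_code q d j = hermitian_code m q"
  unfolding edge_code_def
  by (rule the_equality) (use assms in \<open>auto simp: hermitian_code_def\<close>)

end

(* Write a word c as a family of coefficients on the affine points, and S for its support.
   A product of lines through all points of S but one, P, pairs with c to a nonzero multiple of
   c(P); so no such product may be a combination of the monomials of the code.  If |S| \<le> d, the
   powers of x up to d - 1 show that two points of S share their x-coordinate; were there a point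
   of S off the corresponding vertical line, this line and one more line for each remaining point
   would make a product of degree at most d - 2.  So S is contained in a vertical line, and then the
   powers of y up to d - 2 show |S| = d.  Conversely d points of a vertical line carry a
   one-dimensional space of words.  Each of the q^2 vertical lines meets the curve in q points,
   because y^q + y takes values in the at most q roots of z^q = z, each at most q times. *)
theory Submission
  imports Defs "HOL-Number_Theory.Residues" "HOL-Computational_Algebra.Polynomial"
begin

section \<open>Fibres of the Hermitian curve\<close>

(* finite_field_power_card_eq_same lives in the class finite_field, which the sort {field,finite}
   does not imply. *)
lemma power_CARD_eq_same:
  fixes x :: "'a::{field,finite}"
  shows "x ^ CARD('a) = x"
proof (cases "x = 0")
  case False
  let ?U = "UNIV - {0 :: 'a}"
  \<comment> \<open>Multiplication by \<open>x\<close> permutes the nonzero elements; comparing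
    their product before and after gives \<open>x ^ (CARD('a) - 1) = 1\<close>.\<close>
  have "bij_betw ((*) x) ?U ?U"
    by (rule bij_betwI[where g = "\<lambda>y. y / x"]) (use False in auto)
  then have "prod id ?U = (\<Prod>y\<in>?U. x * y)"
    using prod.reindex_bij_betw[of "(*) x" ?U ?U id] by simp
  also have "\<dots> = x ^ (CARD('a) - 1) * prod id ?U"
    by (simp add: prod.distrib)
  finally have "x ^ (CARD('a) - 1) = 1"
    by simp
  then have "x ^ Suc (CARD('a) - 1) = x" by (simp only: power_Suc mult_1_right)
  then show ?thesis by (simp only: Suc_diff_1 zero_less_card_finite)
qed simp

text \<open>The characteristic divides \<open>q\<^sup>2\<close>, so it is the prime of which
  \<open>q\<close> is a power.\<close>

lemma Frobenius_add:
  fixes x y :: "'a::{field,finite}"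
  assumes "primepow q" and "CARD('a) = q\<^sup>2"
  shows "(x + y) ^ q = x ^ q + y ^ q"
proof -
  obtain p k where p: "prime p" "q = p ^ k"
    using assms(1) by (auto simp: primepow_def)
  have char: "prime CHAR('a)"
    using prime_CHAR_semidom finite_imp_CHAR_pos by (metis finite)
  moreover have "CHAR('a) dvd p ^ (k * 2)"
    using CHAR_dvd_CARD[where 'a = 'a] by (simp add: assms(2) p(2) power_mult)
  ultimately have "CHAR('a) = p"
    using p(1) prime_dvd_power primes_dvd_imp_eq by blast
  then show ?thesis
    using freshmans_dream'[OF char, of q k] p(2) by simp
qed

text \<open>Double counting: at most \<open>q\<close> values, each taken at most \<open>q\<close>
  times, must account for all \<open>q\<^sup>2\<close> field elements, so every bound is
  attained.\<close>

lemma card_trace_fibre: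
  fixes b :: "'a::{field,finite}"
  assumes "primepow q" and card: "CARD('a) = q\<^sup>2" and "b ^ q = b"
  shows "card {y. y ^ q + y = b} = q"
proof -
  define fib where "fib b = {y :: 'a. y ^ q + y = b}" for b
  define B where "B = {b :: 'a. b ^ q = b}"
  have q: "1 < q"
    using primepow_gt_Suc_0[OF assms(1)] by simp
  have fib_le: "card (fib b) \<le> q" for b
  proof -
    let ?p = "monom 1 q + (monom 1 1 + [:- b:])"
    have deg: "degree ?p = q"
      using q by (subst degree_add_eq_left) (auto simp: degree_monom_eq degree_add_less)
    then have "?p \<noteq> 0" using q by auto
    then have "card {x. poly ?p x = 0} \<le> q"
      using card_poly_roots_bound[of ?p] deg by simp
    also have "{x. poly ?p x = 0} = fib b"
      by (auto simp: fib_def poly_monom algebra_simps)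
    finally show ?thesis .
  qed
  have "card B \<le> q"
  proof -
    let ?p = "monom 1 q + - monom (1 :: 'a) 1"
    have deg: "degree ?p = q"
      using q by (subst degree_add_eq_left) (auto simp: degree_monom_eq)
    then have "?p \<noteq> 0" using q by auto
    then have "card {x. poly ?p x = 0} \<le> q"
      using card_poly_roots_bound[of ?p] deg by simp
    also have "{x. poly ?p x = 0} = B"
      by (auto simp: B_def poly_monom)
    finally show ?thesis .
  qed
  have "(y ^ q + y) ^ q = y ^ q + y" for y :: 'a
    using power_CARD_eq_same[of y]
    by (simp add: Frobenius_add[OF assms(1,2)] card power2_eq_square power_mult)
  then have "(\<Union>b\<in>B. fib b) = UNIV"
    by (auto simp: B_def fib_def)
  moreover have "card (\<Union>b\<in>B. fib b) = (\<Sum>b\<in>B. card (fib b))"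
    by (intro card_UN_disjoint) (auto simp: fib_def)
  ultimately have sum: "(\<Sum>b\<in>B. card (fib b)) = q\<^sup>2"
    using card by simp
  have "b \<in> B" using assms(3) by (simp add: B_def)
  \<comment> \<open>The other fibres, at most \<open>q - 1\<close> of them, hold at most
    \<open>(q - 1) * q\<close> elements, which leaves at least \<open>q\<close> for this
    one.\<close>
  then have "(\<Sum>b\<in>B. card (fib b)) = card (fib b) + (\<Sum>b\<in>B - {b}. card (fib b))"
    by (simp add: sum.remove)
  also have "\<dots> \<le> card (fib b) + card (B - {b}) * q"
    using sum_bounded_above[of "B - {b}" "\<lambda>b. card (fib b)" q] fib_le by simp
  also have "\<dots> \<le> card (fib b) + (q - 1) * q"
    using \<open>card B \<le> q\<close> \<open>b \<in> B\<close> by (simp add: card_Diff_singleton diff_le_mono)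
  finally have "q\<^sup>2 \<le> card (fib b) + (q - 1) * q"
    by (simp add: sum)
  moreover have "q\<^sup>2 = q + (q - 1) * q"
    using q by (simp add: power2_eq_square algebra_simps)
  ultimately have "card (fib b) = q"
    using fib_le[of b] by simp
  then show ?thesis by (simp add: fib_def)
qed

text \<open>The norm \<open>a ^ (q + 1)\<close> is fixed by the \<open>q\<close>-th power map, so
  the trace equation for \<open>y\<close> has exactly \<open>q\<close> solutions.\<close>

lemma card_hermitian_points_fibre:
  fixes a :: "'a::{field,finite}"
  assumes "primepow q" and "CARD('a) = q\<^sup>2"
  shows "card {P \<in> hermitian_points q. fst P = a} = q"
proof -
  have "{P \<in> hermitian_points q. fst P = a} = Pair a ` {y. y ^ q + y = a ^ (q + 1)}"
    by (auto simp: hermitian_points_def)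
  moreover have "(a ^ (q + 1)) ^ q = a ^ (q + 1)"
  proof -
    have "(a ^ (q + 1)) ^ q = a ^ CARD('a) * a ^ q"
      by (simp add: assms(2) power2_eq_square power_mult power_mult_distrib mult.commute)
    then show ?thesis by (simp add: power_CARD_eq_same)
  qed
  ultimately show ?thesis
    by (simp add: card_image inj_on_def card_trace_fibre[OF assms])
qed

section \<open>Words orthogonal to monomials of small degree\<close>

text \<open>The product expands into powers of \<open>g\<close>. The extra factor
  \<open>g P ^ k\<close> carries the induction: a new linear factor turns the sum for
  \<open>k\<close> into the one for \<open>Suc k\<close> minus a multiple of the one for
  \<open>k\<close>.\<close>

lemma sum_mult_prod_linear_eq_0:
  fixes w g :: "'b \<Rightarrow> 'a::comm_ring_1"
  assumes "finite A" and "\<And>r. r \<le> k + card A \<Longrightarrow> (\<Sum>P\<in>X. w P * g P ^ r) = 0"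
  shows "(\<Sum>P\<in>X. w P * g P ^ k * (\<Prod>i\<in>A. g P - u i)) = 0"
  using assms
proof (induction A arbitrary: k rule: finite_induct)
  case (insert a A)
  let ?S = "\<lambda>k. \<Sum>P\<in>X. w P * g P ^ k * (\<Prod>i\<in>A. g P - u i)"
  have "(\<Sum>P\<in>X. w P * g P ^ k * (\<Prod>i\<in>insert a A. g P - u i)) = ?S (Suc k) - u a * ?S k"
    using insert.hyps
    by (simp add: sum_distrib_left algebra_simps flip: sum_subtractf)
  moreover have "?S (Suc k) = 0" "?S k = 0"
    using insert.prems insert.hyps by (intro insert.IH; simp)+
  ultimately show ?case by simp
qed auto

lemma sum_mult_prod_lines_eq_0:
  fixes c :: "'a::field \<times> 'a \<Rightarrow> 'a"
  assumes "finite A" "finite B"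
    and "\<And>r s. r \<le> card A \<Longrightarrow> s \<le> card B \<Longrightarrow> (\<Sum>P\<in>X. c P * eval_monomial (r, s) P) = 0"
  shows "(\<Sum>P\<in>X. c P * (\<Prod>i\<in>A. fst P - u i) * (\<Prod>i\<in>B. snd P - v i)) = 0"
proof -
  have "(\<Sum>P\<in>X. c P * fst P ^ r * (\<Prod>i\<in>B. snd P - v i)) = 0" if "r \<le> card A" for r
    using sum_mult_prod_linear_eq_0[OF assms(2), of 0 "\<lambda>P. c P * fst P ^ r" snd X v]
      assms(3) that by (simp add: eval_monomial_def mult.assoc)
  then show ?thesis
    using sum_mult_prod_linear_eq_0[OF assms(1), of 0 "\<lambda>P. c P * (\<Prod>i\<in>B. snd P - v i)" fst X u]
    by (simp add: mult_ac)
qed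

text \<open>Points of \<open>A\<close> stand for vertical lines, points of \<open>B\<close> for
  horizontal ones. Lines covering the rest of the support but missing \<open>P\<close> would have a
  product pairing with \<open>c\<close> to a nonzero multiple of \<open>c P\<close>, although it is
  a combination of monomials orthogonal to \<open>c\<close>.\<close>

lemma not_separated_by_lines:
  fixes c :: "'a::field \<times> 'a \<Rightarrow> 'a"
  assumes "finite X" "finite A" "finite B" "P \<in> X" "c P \<noteq> 0"
    and orth: "\<And>r s. r \<le> card A \<Longrightarrow> s \<le> card B \<Longrightarrow> (\<Sum>P\<in>X. c P * eval_monomial (r, s) P) = 0"
    and cover: "\<And>Q. Q \<in> X \<Longrightarrow> c Q \<noteq> 0 \<Longrightarrow> Q \<noteq> P \<Longrightarrow> fst Q \<in> fst ` A \<or> snd Q \<in> snd ` B"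
  shows "fst P \<in> fst ` A \<or> snd P \<in> snd ` B"
proof (rule ccontr)
  let ?L = "\<lambda>Q. (\<Prod>i\<in>A. fst Q - fst i) * (\<Prod>i\<in>B. snd Q - snd i)"
  assume P: "\<not> ?thesis"
  have "c Q * ?L Q = 0" if "Q \<in> X - {P}" for Q
  proof (cases "c Q = 0")
    case False
    then have "fst Q \<in> fst ` A \<or> snd Q \<in> snd ` B" using cover that by auto
    then have "?L Q = 0" using assms(2,3) by auto
    then show ?thesis by simp
  qed simp
  then have "(\<Sum>Q\<in>X - {P}. c Q * ?L Q) = 0" by (intro sum.neutral ballI)
  then have "(\<Sum>Q\<in>X. c Q * ?L Q) = c P * ?L P"
    using sum.remove[OF assms(1,4), of "\<lambda>Q. c Q * ?L Q"] by simp
  moreover have "(\<Sum>Q\<in>X. c Q * ?L Q) = 0"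
    using sum_mult_prod_lines_eq_0[OF assms(2,3) orth] by (simp add: mult.assoc)
  moreover have "?L P \<noteq> 0" using assms(2,3) P by auto
  ultimately show False using assms(5) by simp
qed

section \<open>Words of weight at most d\<close>

definition orthogonal :: "('a \<times> 'a) set \<Rightarrow> nat \<Rightarrow> nat \<Rightarrow> ('a::field \<times> 'a \<Rightarrow> 'a) \<Rightarrow> bool" where
  "orthogonal X d j c \<longleftrightarrow> (\<forall>f\<in>edge_monomials d j. (\<Sum>P\<in>X. c P * eval_monomial f P) = 0)"

definition support :: "('a \<times> 'a) set \<Rightarrow> ('a::field \<times> 'a \<Rightarrow> 'a) \<Rightarrow> ('a \<times> 'a) set" where
  "support X c = {P \<in> X. c P \<noteq> 0}"

lemma orthogonal_cong:
  "(\<And>P. P \<in> X \<Longrightarrow> c P = c' P) \<Longrightarrow> orthogonal X d j c \<longleftrightarrow> orthogonal X d j c'"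
  unfolding orthogonal_def by (auto cong: sum.cong)

lemma orthogonal_diff:
  "orthogonal X d j c \<Longrightarrow> orthogonal X d j c' \<Longrightarrow> orthogonal X d j (\<lambda>P. c P - c' P)"
  unfolding orthogonal_def by (simp add: left_diff_distrib sum_subtractf)

lemma orthogonal_scale:
  "orthogonal X d j c \<Longrightarrow> orthogonal X d j (\<lambda>P. a * c P)"
  unfolding orthogonal_def by (simp add: mult.assoc flip: sum_distrib_left)

text \<open>The monomials that serve here are those of degree at most \<open>d - 2\<close> and
  \<open>x^(d-1)\<close>, the edge monomial with \<open>i = 1\<close>, present since
  \<open>j\<close> \<ge> 1.\<close>

lemma support_edge_word:
  fixes c :: "'a::field \<times> 'a \<Rightarrow> 'a"
  assumes "finite X" "2 \<le> d" "1 \<le> j" and orth: "orthogonal X d j c"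
    and nonzero: "support X c \<noteq> {}" and le: "card (support X c) \<le> d"
  shows "card (support X c) = d" and "\<exists>a. \<forall>P\<in>support X c. fst P = a"
proof -
  define S where "S = support X c"
  have finS: "finite S" using assms(1) by (simp add: S_def support_def)
  have S: "P \<in> S \<longleftrightarrow> P \<in> X \<and> c P \<noteq> 0" for P
    by (simp add: S_def support_def)
  have deg: "(\<Sum>P\<in>X. c P * eval_monomial (r, s) P) = 0"
    if "r + s \<le> d - 2 \<or> (r \<le> d - 1 \<and> s = 0)" for r s
  proof -
    have "(r, s) \<in> edge_monomials d j"
    proof (cases "r + s \<le> d - 2")
      case True
      then show ?thesis by (simp add: edge_monomials_def)
    next
      case False
      then have "r = d - 1" "s = 1 - 1" using that by auto
      then show ?thesis using assms(3) unfolding edge_monomials_def by blast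
    qed
    then show ?thesis using orth by (auto simp: orthogonal_def)
  qed
  obtain P1 where P1: "P1 \<in> S" using nonzero S_def by blast
  have "\<not> inj_on fst S"
  proof
    assume inj: "inj_on fst S"
    \<comment> \<open>With distinct x-coordinates, at most \<open>d - 1\<close> vertical lines
      through the other points miss \<open>P1\<close>; their product has degree at most
      \<open>d - 1\<close> in x alone.\<close>
    have small: "card (S - {P1}) \<le> d - 1"
      using P1 le finS by (simp add: S_def)
    have "fst P1 \<in> fst ` (S - {P1}) \<or> snd P1 \<in> snd ` ({} :: ('a \<times> 'a) set)"
      by (rule not_separated_by_lines[OF assms(1), where c = c])
        (use small P1 finS S in \<open>auto intro!: deg\<close>)
    then show False using inj P1 by (auto simp: inj_on_def)
  qed
  then obtain P1 P2 where P12: "P1 \<in> S" "P2 \<in> S" "P1 \<noteq> P2" "fst P1 = fst P2"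
    by (auto simp: inj_on_def)
  have vert: "fst P = fst P1" if P: "P \<in> S" for P
  proof (rule ccontr)
    assume off: "fst P \<noteq> fst P1"
    \<comment> \<open>One vertical line removes both \<open>P1\<close> and \<open>P2\<close>. Each
      remaining point gets a line missing \<open>P\<close>: vertical if it lies off the column of
      \<open>P\<close>, horizontal if it lies in it. This makes at most 1 + (d - 3) lines.\<close>
    define R where "R = S - {P, P1, P2}"
    define A where "A = {Q \<in> R. fst Q \<noteq> fst P}"
    define B where "B = {Q \<in> R. fst Q = fst P}"
    have "P \<noteq> P1" "P \<noteq> P2" using off P12 by auto
    then have "card {P, P1, P2} = 3" using P12(3) by auto
    then have R: "card R = card S - 3"
      unfolding R_def using P P12 by (subst card_Diff_subset) auto
    have "3 \<le> card S"
      using card_mono[OF finS, of "{P, P1, P2}"] \<open>card {P, P1, P2} = 3\<close> P P12 by auto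
    have fin: "finite R" "finite A" "finite B"
      using finS by (auto simp: R_def A_def B_def)
    have "card A + card B = card R"
    proof -
      have "A \<union> B = R" "A \<inter> B = {}" by (auto simp: A_def B_def)
      then show ?thesis using card_Un_disjoint[of A B] fin by simp
    qed
    moreover have "card (insert P1 A) \<le> Suc (card A)"
      using fin by (simp add: card_insert_if)
    ultimately have small: "card (insert P1 A) + card B \<le> d - 2"
      using R \<open>3 \<le> card S\<close> le by (simp add: S_def)
    have "fst P \<in> fst ` insert P1 A \<or> snd P \<in> snd ` B"
    proof (rule not_separated_by_lines[OF assms(1), where c = c])
      fix Q assume "Q \<in> X" "c Q \<noteq> 0" "Q \<noteq> P"
      then have "Q = P1 \<or> Q = P2 \<or> Q \<in> A \<or> Q \<in> B"
        by (auto simp: S R_def A_def B_def)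
      then show "fst Q \<in> fst ` insert P1 A \<or> snd Q \<in> snd ` B"
        using P12(4) by auto
    qed (use small P fin S in \<open>auto intro!: deg\<close>)
    then show False
      using off by (auto simp: A_def B_def R_def prod_eq_iff)
  qed
  then show "\<exists>a. \<forall>P\<in>support X c. fst P = a" unfolding S_def by blast
  \<comment> \<open>On one vertical line the y-coordinates are distinct, so at most
    \<open>d - 2\<close> horizontal lines would isolate \<open>P1\<close>.\<close>
  have "\<not> card S < d"
  proof
    assume "card S < d"
    then have small: "card (S - {P1}) \<le> d - 2"
      using P12(1) finS by simp
    have "fst P1 \<in> fst ` ({} :: ('a \<times> 'a) set) \<or> snd P1 \<in> snd ` (S - {P1})"
      by (rule not_separated_by_lines[OF assms(1), where c = c])
        (use small P12(1) finS S in \<open>auto intro!: deg\<close>)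
    then have "snd P1 \<in> snd ` (S - {P1})" by simp
    then show False
    proof
      fix Q assume "snd P1 = snd Q" "Q \<in> S - {P1}"
      then show False using vert[of Q] by (simp add: prod_eq_iff)
    qed
  qed
  then show "card (support X c) = d" using le by (simp add: S_def)
qed

text \<open>Subtracting the multiple of \<open>c\<close> that agrees with \<open>c'\<close> at one
  support point leaves a word of weight below \<open>d\<close>, which must vanish.\<close>

lemma edge_words_same_support_proportional:
  fixes c c' :: "'a::field \<times> 'a \<Rightarrow> 'a"
  assumes "finite X" "2 \<le> d" "1 \<le> j" "orthogonal X d j c" "orthogonal X d j c'"
    and "support X c' = support X c" "card (support X c) = d"
  shows "\<exists>l. l \<noteq> 0 \<and> (\<forall>P\<in>X. c' P = l * c P)"
proof -
  have "support X c \<noteq> {}" using assms(2,7) by auto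
  then obtain P where P: "P \<in> support X c" by blast
  define l where "l = c' P / c P"
  have nz: "c P \<noteq> 0" "c' P \<noteq> 0" using P assms(6) by (auto simp: support_def)
  let ?e = "\<lambda>Q. c' Q - l * c Q"
  have "c' Q = 0" if "Q \<in> X" "c Q = 0" for Q
    using that assms(6) by (auto simp: support_def)
  moreover have "?e P = 0" using nz by (simp add: l_def)
  ultimately have "support X ?e \<subseteq> support X c - {P}"
    by (auto simp: support_def)
  then have "card (support X ?e) \<le> card (support X c - {P})"
    using assms(1) by (intro card_mono) (auto simp: support_def)
  also have "\<dots> = d - 1" using P assms(1,7) by simp
  finally have "card (support X ?e) \<le> d" "card (support X ?e) \<noteq> d"
    using assms(2) by auto
  moreover have "orthogonal X d j ?e"
    using assms(4,5) by (intro orthogonal_diff orthogonal_scale)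
  ultimately have "support X ?e = {}"
    using support_edge_word(1)[OF assms(1-3)] by blast
  then have "\<forall>Q\<in>X. c' Q = l * c Q" by (auto simp: support_def)
  moreover have "l \<noteq> 0" using nz by (simp add: l_def)
  ultimately show ?thesis by blast
qed

text \<open>There are more coefficient vectors than vectors of power sums, so two of them collide,
  and their difference is the solution.\<close>

lemma ex_nonzero_orthogonal_to_powers:
  fixes g :: "'b \<Rightarrow> 'a::{field,finite}"
  assumes "finite T" "n < card T"
  shows "\<exists>c. (\<exists>P\<in>T. c P \<noteq> 0) \<and> (\<forall>s<n. (\<Sum>P\<in>T. c P * g P ^ s) = 0)"
proof -
  define M where "M = (\<lambda>c. restrict (\<lambda>s. \<Sum>P\<in>T. c P * g P ^ s) {..<n})"
  let ?D = "T \<rightarrow>\<^sub>E (UNIV :: 'a set)" and ?E = "{..<n} \<rightarrow>\<^sub>E (UNIV :: 'a set)"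
  have "card {0, 1 :: 'a} \<le> CARD('a)" by (intro card_mono) auto
  then have "1 < CARD('a)" by simp
  have "card (M ` ?D) \<le> card ?E"
    by (intro card_mono finite_PiE) (auto simp: M_def split: if_splits)
  also have "\<dots> < card ?D"
    using assms \<open>1 < CARD('a)\<close> by (simp add: card_funcsetE power_strict_increasing)
  finally have "\<not> inj_on M ?D" by (rule pigeonhole)
  then obtain c c' where c: "c \<in> ?D" "c' \<in> ?D" "c \<noteq> c'" "M c = M c'"
    by (auto simp: inj_on_def)
  have "(\<Sum>P\<in>T. (c P - c' P) * g P ^ s) = 0" if "s < n" for s
    using fun_cong[OF c(4), of s] that
    by (simp add: M_def left_diff_distrib sum_subtractf)
  moreover have "\<exists>P\<in>T. c P - c' P \<noteq> 0"
    using c(3) PiE_ext[OF c(1,2)] by auto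
  ultimately show ?thesis by (intro exI[of _ "\<lambda>P. c P - c' P"]) auto
qed

text \<open>On x = \<open>a\<close> the monomial x^r y^s reduces to a multiple of y^s, leaving
  \<open>d - 1\<close> conditions on \<open>d\<close> coefficients. A nonzero solution has full
  support \<open>T\<close> by the weight bound.\<close>

lemma ex_edge_word_on_vertical_points:
  fixes a :: "'a::{field,finite}"
  assumes "finite X" "2 \<le> d" "1 \<le> j" "j \<le> d - 1"
    and T: "T \<subseteq> X" "card T = d" "\<And>P. P \<in> T \<Longrightarrow> fst P = a"
  shows "\<exists>c. orthogonal X d j c \<and> support X c = T"
proof -
  have "finite T" using assms(1) T(1) finite_subset by blast
  then obtain c0 where c0: "\<exists>P\<in>T. c0 P \<noteq> 0"
      "\<And>s. s < d - 1 \<Longrightarrow> (\<Sum>P\<in>T. c0 P * snd P ^ s) = 0"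
    using ex_nonzero_orthogonal_to_powers[of T "d - 1" snd] T(2) assms(2) by auto
  define c where "c P = (if P \<in> T then c0 P else 0)" for P
  have "(\<Sum>P\<in>X. c P * eval_monomial (r, s) P) = 0" if "(r, s) \<in> edge_monomials d j" for r s
  proof -
    \<comment> \<open>For an edge monomial, s = i - 1 with i \<le> j \<le> d - 1.\<close>
    have "s < d - 1"
      using that assms(2-4) by (auto simp: edge_monomials_def)
    have "(\<Sum>P\<in>X. c P * eval_monomial (r, s) P) = (\<Sum>P\<in>T. c P * eval_monomial (r, s) P)"
      using assms(1) T(1) by (intro sum.mono_neutral_right) (auto simp: c_def)
    also have "\<dots> = (\<Sum>P\<in>T. a ^ r * (c0 P * snd P ^ s))"
      using T(3) by (intro sum.cong) (auto simp: c_def eval_monomial_def)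
    also have "\<dots> = 0"
      using c0(2)[OF \<open>s < d - 1\<close>] by (simp flip: sum_distrib_left)
    finally show ?thesis .
  qed
  then have orth: "orthogonal X d j c" by (auto simp: orthogonal_def)
  have sub: "support X c \<subseteq> T" by (auto simp: support_def c_def)
  have ne: "support X c \<noteq> {}" using c0(1) T(1) by (auto simp: support_def c_def)
  have "card (support X c) = d"
    using support_edge_word(1)[OF assms(1-3) orth ne] card_mono[OF \<open>finite T\<close> sub] T(2) by simp
  then have "support X c = T"
    using sub \<open>finite T\<close> T(2) by (simp add: card_subset_eq)
  then show ?thesis using orth by blast
qed

section \<open>Counting words of minimum weight\<close>

text \<open>These words are the nonzero scalar multiples of a single one; \<open>restrict\<close>
  keeps the multiples extensional.\<close>

lemma card_edge_words_with_support:
  fixes X :: "('a::{field,finite} \<times> 'a) set"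
  assumes "2 \<le> d" "1 \<le> j" "j \<le> d - 1"
    and T: "T \<subseteq> X" "card T = d" "\<And>P. P \<in> T \<Longrightarrow> fst P = a"
  shows "card {c \<in> X \<rightarrow>\<^sub>E UNIV. orthogonal X d j c \<and> support X c = T} = CARD('a) - 1"
proof -
  obtain c0 where c0: "orthogonal X d j c0" "support X c0 = T"
    using ex_edge_word_on_vertical_points[OF finite assms(1-3) T] by blast
  define F where "F = (\<lambda>l. restrict (\<lambda>P. l * c0 P) X)"
  have "T \<noteq> {}" using T(2) assms(1) by auto
  then obtain P where P: "P \<in> X" "c0 P \<noteq> 0" using c0(2) by (auto simp: support_def)
  have "inj_on F (UNIV - {0})"
  proof (rule inj_onI)
    fix l l' assume "F l = F l'"
    then have "F l P = F l' P" by simp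
    then show "l = l'" using P by (simp add: F_def)
  qed
  moreover have "{c \<in> X \<rightarrow>\<^sub>E UNIV. orthogonal X d j c \<and> support X c = T} = F ` (UNIV - {0})"
  proof (intro equalityI subsetI)
    fix c assume "c \<in> {c \<in> X \<rightarrow>\<^sub>E UNIV. orthogonal X d j c \<and> support X c = T}"
    then have c: "c \<in> X \<rightarrow>\<^sub>E UNIV" "orthogonal X d j c" "support X c = T" by auto
    then obtain l where l: "l \<noteq> 0" "\<forall>P\<in>X. c P = l * c0 P"
      using edge_words_same_support_proportional[OF finite assms(1,2) c0(1) c(2)] c0(2) T(2) by auto
    have "c = F l"
      by (rule PiE_ext[OF c(1)]) (use l in \<open>auto simp: F_def\<close>)
    then show "c \<in> F ` (UNIV - {0})" using l(1) by blast
  next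
    fix c assume "c \<in> F ` (UNIV - {0})"
    then obtain l where l: "c = F l" "l \<noteq> 0" by auto
    have "orthogonal X d j (F l)"
      using orthogonal_scale[OF c0(1)] orthogonal_cong[of X "F l" "\<lambda>P. l * c0 P"]
      by (simp add: F_def)
    moreover have "support X (F l) = T"
      using l(2) c0(2) by (auto simp: F_def support_def)
    ultimately show "c \<in> {c \<in> X \<rightarrow>\<^sub>E UNIV. orthogonal X d j c \<and> support X c = T}"
      using l(1) by (simp add: F_def)
  qed
  ultimately show ?thesis by (simp add: card_image)
qed

text \<open>A nonempty set lies on at most one vertical line, so the choices on different lines are
  disjoint.\<close>

lemma card_vertical_subsets:
  fixes X :: "('a::finite \<times> 'a) set"
  assumes "1 \<le> d" and fibre: "\<And>a. card {P \<in> X. fst P = a} = n"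
  shows "card {T. T \<subseteq> X \<and> card T = d \<and> (\<exists>a. \<forall>P\<in>T. fst P = a)} = CARD('a) * (n choose d)"
proof -
  define V where "V a = {T. T \<subseteq> {P \<in> X. fst P = a} \<and> card T = d}" for a
  have "{T. T \<subseteq> X \<and> card T = d \<and> (\<exists>a. \<forall>P\<in>T. fst P = a)} = (\<Union>a. V a)"
    by (auto simp: V_def)
  also have "card \<dots> = (\<Sum>a\<in>UNIV. card (V a))"
  proof (intro card_UN_disjoint ballI impI)
    fix a b :: 'a assume "a \<noteq> b"
    have "T \<notin> V b" if "T \<in> V a" for T
    proof -
      have "T \<noteq> {}" using that assms(1) by (auto simp: V_def)
      then show ?thesis using that \<open>a \<noteq> b\<close> by (auto simp: V_def)
    qed
    then show "V a \<inter> V b = {}" by blast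
  qed auto
  also have "\<dots> = CARD('a) * (n choose d)"
    by (simp add: V_def n_subsets fibre)
  finally show ?thesis .
qed

text \<open>The words are sorted by support. The curve will enter only through the common size
  \<open>n\<close> of its vertical fibres.\<close>

lemma card_minimum_weight_edge_words:
  fixes X :: "('a::{field,finite} \<times> 'a) set"
  assumes "2 \<le> d" "1 \<le> j" "j \<le> d - 1" and fibre: "\<And>a. card {P \<in> X. fst P = a} = n"
  shows "card {c \<in> X \<rightarrow>\<^sub>E UNIV. orthogonal X d j c \<and> card (support X c) = d} =
    CARD('a) * (n choose d) * (CARD('a) - 1)"
proof -
  let ?V = "{T. T \<subseteq> X \<and> card T = d \<and> (\<exists>a. \<forall>P\<in>T. fst P = a)}"
  define W where "W T = {c \<in> X \<rightarrow>\<^sub>E UNIV. orthogonal X d j c \<and> support X c = T}" for T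
  have "{c \<in> X \<rightarrow>\<^sub>E UNIV. orthogonal X d j c \<and> card (support X c) = d} = (\<Union>T\<in>?V. W T)"
  proof (intro equalityI subsetI)
    fix c assume "c \<in> {c \<in> X \<rightarrow>\<^sub>E UNIV. orthogonal X d j c \<and> card (support X c) = d}"
    then have c: "c \<in> X \<rightarrow>\<^sub>E UNIV" "orthogonal X d j c" "card (support X c) = d" by auto
    then have "support X c \<noteq> {}" using assms(1) by auto
    then have "support X c \<in> ?V"
      using support_edge_word(2)[OF finite assms(1,2) c(2)] c(3) by (auto simp: support_def)
    then show "c \<in> (\<Union>T\<in>?V. W T)" using c by (auto simp: W_def)
  qed (auto simp: W_def)
  also have "card \<dots> = (\<Sum>T\<in>?V. card (W T))"
    by (intro card_UN_disjoint) (auto simp: W_def finite_PiE)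
  also have "\<dots> = (\<Sum>T\<in>?V. CARD('a) - 1)"
    unfolding W_def using card_edge_words_with_support[OF assms(1-3)]
    by (intro sum.cong refl) blast
  also have "\<dots> = CARD('a) * (n choose d) * (CARD('a) - 1)"
    using card_vertical_subsets[OF _ fibre, of d] assms(1) by simp
  finally show ?thesis .
qed

section \<open>Minimum distance and weight count of the edge code\<close>

lemma edge_code_eq_orthogonal:
  assumes "2 \<le> d" "d \<le> q" "1 \<le> j" "j \<le> d - 1"
  shows "edge_code q d j =
    {c \<in> hermitian_points q \<rightarrow>\<^sub>E UNIV. orthogonal (hermitian_points q) d j c}"
  using edge_code_eq[OF hermitian_monomials_edge[OF assms]] hermitian_monomials_edge[OF assms]
  by (simp add: hermitian_code_def words_def orthogonal_def)

text \<open>The given word is at distance \<open>d\<close> from zero, and differences of distinct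
  codewords have weight at least \<open>d\<close>.\<close>

lemma minimum_distance_edge_code:
  fixes c :: "'a::{field,finite} \<times> 'a \<Rightarrow> 'a"
  assumes "2 \<le> d" "d \<le> q" "1 \<le> j" "j \<le> d - 1"
    and c: "c \<in> edge_code q d j" "hamming_weight q c = d"
  shows "minimum_distance q (edge_code q d j :: ('a \<times> 'a \<Rightarrow> 'a) set) = d"
proof -
  let ?X = "hermitian_points q :: ('a \<times> 'a) set"
  let ?D = "{hamming_distance q c c' | c c' :: 'a \<times> 'a \<Rightarrow> 'a. c \<in> edge_code q d j \<and> c' \<in> edge_code q d j \<and> c \<noteq> c'}"
  note code = edge_code_eq_orthogonal[OF assms(1-4)]
  define z where "z = restrict (\<lambda>_. 0 :: 'a) ?X"
  have "orthogonal ?X d j z"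
    by (auto simp: orthogonal_def z_def)
  then have z: "z \<in> edge_code q d j" by (simp add: code z_def)
  have wt: "hamming_distance q c z = d"
  proof -
    have "{P \<in> ?X. c P \<noteq> z P} = {P \<in> ?X. c P \<noteq> 0}" by (auto simp: z_def)
    then show ?thesis using c(2) by (simp add: hamming_distance_def hamming_weight_def)
  qed
  then have "c \<noteq> z" using assms(1) by (auto simp: hamming_distance_def)
  then have mem: "d \<in> ?D" using z c(1) wt by blast
  have low: "d \<le> w" if "w \<in> ?D" for w
  proof -
    obtain c1 c2 :: "'a \<times> 'a \<Rightarrow> 'a" where w: "w = hamming_distance q c1 c2" "c1 \<noteq> c2"
        and mems: "c1 \<in> edge_code q d j" "c2 \<in> edge_code q d j"
      using \<open>w \<in> ?D\<close> by blast
    \<comment> \<open>This difference need not be extensional, but \<open>orthogonal\<close> and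
      \<open>support\<close> look only at points of the curve.\<close>
    let ?e = "\<lambda>P. c1 P - c2 P"
    have PiE: "c1 \<in> ?X \<rightarrow>\<^sub>E UNIV" "c2 \<in> ?X \<rightarrow>\<^sub>E UNIV"
      using mems by (simp_all add: code)
    have orth: "orthogonal ?X d j ?e"
      using mems by (intro orthogonal_diff) (auto simp: code)
    have "support ?X ?e \<noteq> {}"
      using w(2) PiE_ext[OF PiE] by (auto simp: support_def)
    then have "d \<le> card (support ?X ?e)"
      using support_edge_word(1)[OF finite assms(1,3) orth] by linarith
    then show ?thesis by (simp add: w hamming_distance_def support_def)
  qed
  show ?thesis
    unfolding minimum_distance_def
    by (rule cInf_eq_minimum[OF mem low])
qed

theorem theorem4p6:
  fixes q d j :: nat
    and C :: "('a::{field,finite} \<times> 'a \<Rightarrow> 'a) set"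
  assumes "primepow q"
    and "CARD('a) = q\<^sup>2"
    and "2 \<le> d" and "d \<le> q"
    and "1 \<le> j" and "j \<le> d - 1"
    and "C = edge_code q d j"
  shows "num_words_of_weight q C (minimum_distance q C) = num_words_of_weight q C d
    \<and> num_words_of_weight q C d = q\<^sup>2 * (q\<^sup>2 - 1) * (q choose d)"
proof -
  let ?X = "hermitian_points q :: ('a \<times> 'a) set"
  have words: "{c \<in> C. hamming_weight q c = d} =
      {c \<in> ?X \<rightarrow>\<^sub>E UNIV. orthogonal ?X d j c \<and> card (support ?X c) = d}"
    using assms(7) by (auto simp: edge_code_eq_orthogonal[OF assms(3-6)] hamming_weight_def support_def)
  have num: "num_words_of_weight q C d = q\<^sup>2 * (q\<^sup>2 - 1) * (q choose d)"
    unfolding num_words_of_weight_def words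
    using card_minimum_weight_edge_words[OF assms(3,5,6) card_hermitian_points_fibre[OF assms(1,2)]]
    by (simp add: assms(2) mult_ac)
  \<comment> \<open>The count is positive, so weight \<open>d\<close> is attained and
    \<open>d\<close> is the minimum distance.\<close>
  have "1 < q\<^sup>2" using assms(3,4) by (simp add: power2_eq_square one_less_mult)
  then have "num_words_of_weight q C d \<noteq> 0"
    using assms(3,4) num by simp
  then obtain c where "c \<in> C" "hamming_weight q c = d"
    by (metis (mono_tags, lifting) card.empty empty_Collect_eq num_words_of_weight_def)
  then have "minimum_distance q C = d"
    using minimum_distance_edge_code[OF assms(3-6)] assms(7) by blast
  then show ?thesis using num by simp
qed

end
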